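(* Let $h \geq 2$. Let $X$ be a countably infinite set, and let $\mathcal{A}$ be a set of finite subsets of $X$. For every finite subset $S$ of $X$, let $g_{\mathcal{A},h}(S)$ be the number of $h$-tuples $(A_1,\ldots,A_h) \in \mathcal{A} \times \cdots \times \mathcal{A}$ such that $A_i \cap A_j = \emptyset$ for $1 \leq i < j \leq h$ and $S = \bigcup_{i=1}^h A_i$. Let $W$ be an infinite set of positive integers such that for every $n \in W$, one has $g_{\mathcal{A},h}(S) \geq 1$ for all but finitely many sets $S \in [X]^n$. Then for every integer $n$ there is a finite subset $S$ of $X$ with $g_{\mathcal{A},h}(S) \geq n$.
   Context: For a set $X$ and a nonnegative integer $k$, $[X]^k$ denotes the set of all subsets of $X$ of cardinality $k$. *)

theory Defs
  imports "HOL-Library.Ramsey" "HOL-Library.Countable_Set"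
begin

text \<open>
  Ordered \<open>h\<close>-tuples are lists of length \<open>h\<close>, indexed from \<open>0\<close>. The empty set
  may be a member of \<open>\<A>\<close> and may then occur several times in
  one tuple. For finite \<open>S\<close> all entries are subsets of \<open>S\<close>, so the set of tuples is finite.
\<close>

definition rep_tuples :: "'a set set \<Rightarrow> nat \<Rightarrow> 'a set \<Rightarrow> 'a set list set" where
  "rep_tuples \<A> h S =
     {As. length As = h \<and> (\<forall>i<h. As ! i \<in> \<A>) \<and>
          (\<forall>i j. i < j \<and> j < h \<longrightarrow> As ! i \<inter> As ! j = {}) \<and>
          S = (\<Union>i<h. As ! i)}"

definition rep_count :: "'a set set \<Rightarrow> nat \<Rightarrow> 'a set \<Rightarrow> nat" where
  "rep_count \<A> h S = card (rep_tuples \<A> h S)"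

lemma finite_rep_tuples:
  assumes "finite S"
  shows "finite (rep_tuples \<A> h S)"
proof (rule finite_subset)
  show "rep_tuples \<A> h S \<subseteq> {As. set As \<subseteq> Pow S \<and> length As = h}"
    by (fastforce simp: rep_tuples_def in_set_conv_nth)
  show "finite {As. set As \<subseteq> Pow S \<and> length As = h}"
    using assms by (intro finite_lists_length_eq) simp
qed

end

theory Submission
  imports Defs "HOL-Library.Disjoint_Sets"
begin

text \<open>
  Fix a large \<open>n \<in> W\<close>. By Ramsey's theorem there is an infinite \<open>Y \<subseteq> X\<close> such that, for each
  \<open>k \<le> n\<close>, either all \<open>k\<close>-subsets of \<open>Y\<close> lie in \<open>\<A>\<close> or none do. Some \<open>n\<close>-subset of \<open>Y\<close> is
  represented, with parts of sizes \<open>k\<^sub>1, \<dots>, k\<^sub>h\<close> say, hence all \<open>k\<^sub>i\<close>-subsets of \<open>Y\<close> lie in \<open>\<A>\<close>, and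
  every \<open>n\<close>-subset of \<open>Y\<close> has at least \<open>n choose k\<^sub>i\<close> representations. This is at least \<open>n\<close> if
  \<open>0 < k\<^sub>i < n\<close>. Otherwise the sizes are \<open>n, 0, \<dots>, 0\<close>, and splitting a \<open>2n\<close>-subset of \<open>Y\<close> with
  sizes \<open>n, n, 0, \<dots>, 0\<close> gives at least \<open>2n choose n\<close> representations.
\<close>

text \<open>Ramsey's theorem is applied to one size after another. Homogeneity already obtained for
  smaller sizes survives each passage to an infinite subset.\<close>

lemma infinite_subset_homogeneous_below:
  assumes "infinite Z"
  shows "\<exists>Y\<subseteq>Z. infinite Y \<and> (\<forall>k<n. [Y]\<^bsup>k\<^esup> \<subseteq> \<A> \<or> [Y]\<^bsup>k\<^esup> \<inter> \<A> = {})"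
proof (induction n)
  case 0
  show ?case using assms by auto
next
  case (Suc n)
  then obtain Y where Y: "Y \<subseteq> Z" "infinite Y"
      "\<forall>k<n. [Y]\<^bsup>k\<^esup> \<subseteq> \<A> \<or> [Y]\<^bsup>k\<^esup> \<inter> \<A> = {}" by blast
  \<comment> \<open>Membership in \<open>\<A>\<close> becomes a colouring with colours 0 and 1, the
    form that \<open>Ramsey_nsets\<close> expects.\<close>
  define c :: "'a set \<Rightarrow> nat" where "c S = of_bool (S \<in> \<A>)" for S
  have "c ` [Y]\<^bsup>n\<^esup> \<subseteq> {..<2}" by (auto simp: c_def)
  then obtain Y' t where Y': "Y' \<subseteq> Y" "infinite Y'" "c ` [Y']\<^bsup>n\<^esup> \<subseteq> {t}"
    using Ramsey_nsets[OF Y(2)] by metis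
  have "[Y']\<^bsup>k\<^esup> \<subseteq> \<A> \<or> [Y']\<^bsup>k\<^esup> \<inter> \<A> = {}" if "k < Suc n" for k
  proof (cases "k = n")
    case True
    then show ?thesis using Y'(3) by (cases "t = 0") (auto simp: c_def image_subset_iff)
  next
    case False
    then have "[Y]\<^bsup>k\<^esup> \<subseteq> \<A> \<or> [Y]\<^bsup>k\<^esup> \<inter> \<A> = {}" using Y(3) that by simp
    then show ?thesis using nsets_mono[OF Y'(1), of k] by blast
  qed
  then show ?case using Y(1) Y'(1,2) by (intro exI[of _ Y']) auto
qed

text \<open>Blocks are carved off one at a time. This fills the remaining entries of a tuple once
  one entry is prescribed; size 0 is allowed, so blocks may be empty.\<close>

lemma finite_partition_into_sizes:
  assumes "finite I" "finite S" "card S = sum k I"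
  shows "\<exists>f. disjoint_family_on f I \<and> (\<Union>i\<in>I. f i) = S \<and> (\<forall>i\<in>I. card (f i) = k i)"
  using assms
proof (induction I arbitrary: S rule: finite_induct)
  case empty
  then show ?case by (auto simp: disjoint_family_on_def)
next
  case (insert i I)
  then obtain T where T: "T \<subseteq> S" "card T = k i"
    by (metis le_add1 obtain_subset_with_card_n sum.insert)
  have "card (S - T) = sum k I"
    using insert T by (simp add: card_Diff_subset finite_subset)
  then obtain f where f: "disjoint_family_on f I" "(\<Union>i\<in>I. f i) = S - T" "\<forall>i\<in>I. card (f i) = k i"
    using insert by (metis finite_Diff)
  have "disjoint_family_on (f(i := T)) (insert i I)"
    using f(1,2) insert(2) by (fastforce simp: disjoint_family_on_def)
  moreover have "(\<Union>j\<in>insert i I. (f(i := T)) j) = S"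
    using f(2) T(1) insert(2) by auto
  moreover have "\<forall>j\<in>insert i I. card ((f(i := T)) j) = k j"
    using f(3) T(2) by auto
  ultimately show ?case by blast
qed

text \<open>Any subset \<open>T\<close> of \<open>S\<close> of size \<open>k i\<close> can serve as
  entry \<open>i\<close>: split \<open>S - T\<close> into blocks of the other sizes. Different
  choices of \<open>T\<close> give different tuples.\<close>

lemma rep_count_ge_binomial:
  assumes "finite S" "i < h" "card S = sum k {..<h}"
    and in_A: "\<And>j. j < h \<Longrightarrow> [S]\<^bsup>k j\<^esup> \<subseteq> \<A>"
  shows "card S choose k i \<le> rep_count \<A> h S"
proof -
  have ex: "\<exists>As \<in> rep_tuples \<A> h S. As ! i = T" if T: "T \<in> [S]\<^bsup>k i\<^esup>" for T
  proof -
    have "card (S - T) = sum k ({..<h} - {i})"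
      using T assms(1-3) by (simp add: nsets_def card_Diff_subset sum_diff1_nat)
    then obtain f where f: "disjoint_family_on f ({..<h} - {i})" "(\<Union>j\<in>{..<h} - {i}. f j) = S - T"
        "\<forall>j\<in>{..<h} - {i}. card (f j) = k j"
      using finite_partition_into_sizes[of "{..<h} - {i}" "S - T" k] assms(1) by auto
    define g where "g = f(i := T)"
    have "{..<h} = insert i ({..<h} - {i})" using assms(2) by auto
    then have "(\<Union>j<h. g j) = g i \<union> (\<Union>j\<in>{..<h} - {i}. g j)" by (metis UN_insert)
    also have "\<dots> = T \<union> (S - T)" by (simp add: g_def flip: f(2))
    finally have S: "(\<Union>j<h. g j) = S" using T by (auto simp: nsets_def)
    have "g j \<in> [S]\<^bsup>k j\<^esup>" if "j < h" for j
    proof -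
      have "g j \<subseteq> S" using S that by blast
      moreover have "card (g j) = k j" using f(3) T that by (simp add: g_def nsets_def)
      ultimately show ?thesis using assms(1) by (simp add: nsets_def finite_subset)
    qed
    then have "g j \<in> \<A>" if "j < h" for j
      using in_A that by blast
    moreover have "g a \<inter> g b = {}" if ab: "a < b" "b < h" for a b
    proof -
      have T_disj: "f j \<inter> T = {}" if "j < h" "j \<noteq> i" for j
        using f(2) that by blast
      have f_disj: "f a \<inter> f b = {}" if "a \<noteq> i" "b \<noteq> i"
        using f(1) ab that by (intro disjoint_family_onD) auto
      show ?thesis
        using T_disj[of a] T_disj[of b] f_disj ab
        by (cases "a = i"; cases "b = i") (simp_all add: g_def Int_commute)
    qed
    ultimately have "map g [0..<h] \<in> rep_tuples \<A> h S"
      using S by (simp add: rep_tuples_def)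
    then show ?thesis using assms(2) by (intro bexI[of _ "map g [0..<h]"]) (auto simp: g_def)
  qed
  \<comment> \<open>Reading off entry \<open>i\<close> maps a set of tuples onto all subsets of size
    \<open>k i\<close>.\<close>
  have "card ([S]\<^bsup>k i\<^esup>) \<le> card (rep_tuples \<A> h S)"
    by (rule surj_card_le[of _ _ "\<lambda>As. As ! i"]) (use ex finite_rep_tuples[OF assms(1)] in auto)
  then show ?thesis by (simp add: rep_count_def)
qed

text \<open>Induction by Pascal's rule: the second summand is at least \<open>n\<close> and the
  first adds at least 1. The boundary case \<open>Suc l = n\<close> follows by symmetry.\<close>

lemma le_binomial:
  assumes "0 < k" "k < n"
  shows "n \<le> n choose k"
  using assms
proof (induction n arbitrary: k)
  case (Suc n)
  then obtain l where k: "k = Suc l" by (cases k) auto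
  show ?case
  proof (cases "Suc l = n")
    case True
    then show ?thesis by (simp add: k binomial_symmetric[of n "Suc n"])
  next
    case False
    with Suc k have "n \<le> n choose Suc l" "0 < n choose l" by auto
    then show ?thesis unfolding k binomial_Suc_Suc by linarith
  qed
qed simp

theorem theorem4:
  fixes X :: "'a set" and \<A> :: "'a set set" and h :: nat and W :: "nat set"
  assumes "h \<ge> 2"
    and "countable X" and "infinite X"
    and "\<And>A. A \<in> \<A> \<Longrightarrow> finite A \<and> A \<subseteq> X"
    and "infinite W" and "\<And>n. n \<in> W \<Longrightarrow> n > 0"
    and "\<And>n. n \<in> W \<Longrightarrow> finite {S \<in> nsets X n. \<not> rep_count \<A> h S \<ge> 1}"
  shows "\<forall>n::int. \<exists>S. finite S \<and> S \<subseteq> X \<and> int (rep_count \<A> h S) \<ge> n"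
proof
  fix m :: int
  obtain n where n: "n \<in> W" "n \<ge> nat m"
    using assms(5) infinite_nat_iff_unbounded_le by blast
  have "n > 0" using assms(6) n(1) .
  \<comment> \<open>The bound \<open>Suc n\<close> makes size \<open>n\<close> itself
    homogeneous.\<close>
  obtain Y where Y: "Y \<subseteq> X" "infinite Y"
      and hom: "\<forall>k<Suc n. [Y]\<^bsup>k\<^esup> \<subseteq> \<A> \<or> [Y]\<^bsup>k\<^esup> \<inter> \<A> = {}"
    using infinite_subset_homogeneous_below[OF assms(3)] by metis
  \<comment> \<open>As \<open>n > 0\<close>, the infinite set \<open>Y\<close> has infinitely many
    subsets of size \<open>n\<close>, while only finitely many are exceptional.\<close>
  have "\<not> [Y]\<^bsup>n\<^esup> \<subseteq> {S \<in> nsets X n. \<not> rep_count \<A> h S \<ge> 1}"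
    using assms(7)[OF n(1)] infinite_imp_infinite_nsets[OF Y(2) \<open>n > 0\<close>] finite_subset by blast
  then obtain S where S: "S \<in> [Y]\<^bsup>n\<^esup>" "rep_count \<A> h S \<ge> 1"
    using nsets_mono[OF Y(1)] by blast
  have "rep_tuples \<A> h S \<noteq> {}"
    using S(2) by (auto simp: rep_count_def)
  then obtain As where As: "\<And>i. i < h \<Longrightarrow> As ! i \<in> \<A>"
      "\<And>i j. i < j \<Longrightarrow> j < h \<Longrightarrow> As ! i \<inter> As ! j = {}" "S = (\<Union>i<h. As ! i)"
    unfolding rep_tuples_def by blast
  define k where "k i = card (As ! i)" for i
  have fin: "finite S" "card S = n" "S \<subseteq> Y" using S(1) by (auto simp: nsets_def)
  have part: "As ! i \<in> [S]\<^bsup>k i\<^esup>" if "i < h" for i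
    using As(3) fin(1) that by (auto simp: nsets_def k_def intro: finite_subset)
  have k_le: "k i \<le> n" if "i < h" for i
    using part[OF that] card_mono[OF fin(1), of "As ! i"] fin(2) by (simp add: nsets_def)
  \<comment> \<open>The part \<open>As ! i\<close> is a member of \<open>\<A>\<close> of size
    \<open>k i\<close> inside \<open>Y\<close>, which excludes the empty alternative in
    \<open>hom\<close>.\<close>
  have in_A: "[Y]\<^bsup>k i\<^esup> \<subseteq> \<A>" if "i < h" for i
    using hom As(1)[OF that] part[OF that] nsets_mono[OF fin(3)] k_le[OF that]
    by (meson disjoint_iff less_Suc_eq_le subsetD)
  have disj: "As ! i \<inter> As ! j = {}" if "i < h" "j < h" "i \<noteq> j" for i j
    using As(2) that by (metis Int_commute linorder_neqE_nat)
  have "card (\<Union>i<h. As ! i) = sum k {..<h}"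
    unfolding k_def using part disj by (intro card_UN_disjoint) (auto simp: nsets_def)
  then have sum_k: "sum k {..<h} = n" using As(3) fin(2) by simp
  then obtain i where i: "i < h" "k i > 0"
    using \<open>n > 0\<close> by (metis bot_nat_0.not_eq_extremum lessThan_iff sum.neutral)
  have "\<exists>S. finite S \<and> S \<subseteq> Y \<and> rep_count \<A> h S \<ge> n"
  proof (cases "k i = n")
    case False
    then have "n \<le> n choose k i" using i k_le le_binomial by (metis le_neq_implies_less)
    also have "\<dots> \<le> rep_count \<A> h S"
      using rep_count_ge_binomial[OF fin(1) i(1), of k \<A>] sum_k fin(2) in_A nsets_mono[OF fin(3)]
      by (metis subset_trans)
    finally show ?thesis using fin by blast
  next
    case True
    obtain j where j: "j < h" "j \<noteq> i"
      using \<open>h \<ge> 2\<close> by (intro that[of "if i = 0 then 1 else 0"]) auto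
    have zero: "k l = 0" if "l < h" "l \<noteq> i" for l
      using sum_k True that i(1) by (simp add: sum.remove[of "{..<h}" i])
    \<comment> \<open>The second index \<open>j\<close>, available since \<open>h \<ge> 2\<close>,
      carries a part of size 0, so the empty set is that part.\<close>
    have "{} \<in> \<A>" using in_A[OF j(1)] zero[OF j] by simp
    obtain S' where S': "S' \<subseteq> Y" "finite S'" "card S' = 2 * n"
      using infinite_arbitrarily_large[OF Y(2)] by blast
    \<comment> \<open>Two blocks of size \<open>n\<close> replace the single one, so that the
      binomial coefficient is no longer trivial.\<close>
    define k' where "k' l = (if l = i \<or> l = j then n else 0)" for l
    have "sum k' {..<h} = sum k' {i, j}"
      using i(1) j by (intro sum.mono_neutral_right) (auto simp: k'_def)
    then have "card S' = sum k' {..<h}" using j(2) S'(3) by (auto simp: k'_def)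
    moreover have "[S']\<^bsup>k' l\<^esup> \<subseteq> \<A>" for l
      using \<open>{} \<in> \<A>\<close> in_A[OF i(1)] True nsets_mono[OF S'(1)] by (auto simp: k'_def)
    ultimately have "2 * n choose n \<le> rep_count \<A> h S'"
      using rep_count_ge_binomial[OF S'(2) i(1), of k' \<A>] S'(3) by (simp add: k'_def)
    then have "n \<le> rep_count \<A> h S'"
      using le_binomial[of n "2 * n"] \<open>n > 0\<close> by linarith
    then show ?thesis using S' by blast
  qed
  then show "\<exists>S. finite S \<and> S \<subseteq> X \<and> int (rep_count \<A> h S) \<ge> m"
    using Y(1) n(2) by (meson nat_le_iff order_trans)
qed

end
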